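(* Let $S\neq\mathbb{N}$ be a numerical semigroup with maximal ideal $M=S\setminus\{0\}$, and let $a\in\mathbb{N}$ with $a\in M-2M$. Then the dilatation $S+a$ is 2-AGL if and only if $S$ is 2-AGL.
   Context: $\mathbb{N}$ denotes the nonnegative integers. A numerical semigroup $S$ is a submonoid of $(\mathbb{N},+)$ with $\mathbb{N}\setminus S$ finite. With $M=S\setminus\{0\}$, the condition $a\in M-2M$ means $a+s_1+s_2\in M$ for all $s_1,s_2\in M$. For such $a\in\mathbb{N}$, the dilatation of $S$ with respect to $a$ is the numerical semigroup $S+a=\{0\}\cup\{s+a : s\in M\}$ (so here $S+a$ is not the full translate of $S$). $F(S)=\max(\mathbb{N}\setminus S)$ is the Frobenius number, and the canonical ideal of $S$ is $\Omega_S=\{x\in\mathbb{N} : F(S)-x\notin S\}$. For $h\ge1$, $h\Omega_S$ is the $h$-fold sumset $\{x_1+\dots+x_h : x_i\in\Omega_S\}$; since $0\in\Omega_S$ these sets are increasing in $h$. The reduction number of $\Omega_S$ is the smallest positive integer $h$ such that $h\Omega_S=(h+1)\Omega_S$. $S$ is 2-AGL if the reduction number of $\Omega_S$ is $2$ and $|2\Omega_S\setminus\Omega_S|=2$. *)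

theory Defs
  imports Main
begin

definition numerical_semigroup :: "nat set \<Rightarrow> bool" where
  "numerical_semigroup S \<longleftrightarrow> 0 \<in> S \<and> (\<forall>x\<in>S. \<forall>y\<in>S. x + y \<in> S) \<and> finite (UNIV - S)"

definition maximal_ideal :: "nat set \<Rightarrow> nat set" where
  "maximal_ideal S = S - {0}"

definition sumset :: "nat \<Rightarrow> nat set \<Rightarrow> nat set" where
  "sumset h A = {\<Sum>i<h. x i | x. \<forall>i<h. x i \<in> A}"

text \<open>The nonnegative part of the ideal difference \<open>A - B\<close>.\<close>

definition ideal_diff :: "nat set \<Rightarrow> nat set \<Rightarrow> nat set" where
  "ideal_diff A B = {x. \<forall>y\<in>B. x + y \<in> A}"

definition dilatation :: "nat set \<Rightarrow> nat \<Rightarrow> nat set" where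
  "dilatation S a = insert 0 {s + a | s. s \<in> maximal_ideal S}"

text \<open>Only meaningful if the complement of \<open>S\<close> is finite and nonempty.\<close>

definition frobenius :: "nat set \<Rightarrow> nat" where
  "frobenius S = Max (UNIV - S)"

text \<open>The difference is taken in the integers, so every \<open>x > frobenius S\<close> belongs to the
  canonical ideal.\<close>

definition canonical_ideal :: "nat set \<Rightarrow> nat set" where
  "canonical_ideal S = {x. int (frobenius S) - int x \<notin> int ` S}"

definition reduction_number :: "nat set \<Rightarrow> nat" where
  "reduction_number A = (LEAST h. h \<ge> 1 \<and> sumset h A = sumset (h + 1) A)"

definition two_AGL :: "nat set \<Rightarrow> bool" where
  "two_AGL S \<longleftrightarrow>
     reduction_number (canonical_ideal S) = 2 \<and>
     card (sumset 2 (canonical_ideal S) - canonical_ideal S) = 2"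

lemma sumset_2: "sumset 2 A = {x + y | x y. x \<in> A \<and> y \<in> A}"
proof (intro set_eqI iffI)
  fix z assume "z \<in> sumset 2 A"
  then show "z \<in> {x + y | x y. x \<in> A \<and> y \<in> A}"
    by (auto simp: sumset_def numeral_2_eq_2)
next
  fix z assume "z \<in> {x + y | x y. x \<in> A \<and> y \<in> A}"
  then obtain x y where "z = x + y" "x \<in> A" "y \<in> A" by blast
  then show "z \<in> sumset 2 A"
    unfolding sumset_def
    by (intro CollectI exI[of _ "\<lambda>i::nat. if i = 0 then x else y"])
       (simp add: numeral_2_eq_2)
qed

lemma mem_ideal_diff_sumset_2:
  "a \<in> ideal_diff M (sumset 2 M) \<longleftrightarrow> (\<forall>s\<in>M. \<forall>t\<in>M. a + s + t \<in> M)"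
  by (auto simp: ideal_diff_def sumset_2 add.assoc)

lemma numerical_semigroup_dilatation:
  assumes S: "numerical_semigroup S"
    and a: "a \<in> ideal_diff (maximal_ideal S) (sumset 2 (maximal_ideal S))"
  shows "numerical_semigroup (dilatation S a)"
proof -
  let ?M = "maximal_ideal S"
  have closed: "x + y \<in> dilatation S a" if xy: "x \<in> dilatation S a" "y \<in> dilatation S a" for x y
  proof (cases "x = 0 \<or> y = 0")
    case True
    then show ?thesis using that by auto
  next
    case False
    then obtain s t where st: "s \<in> ?M" "t \<in> ?M" "x = s + a" "y = t + a"
      using xy unfolding dilatation_def by blast
    then have "a + s + t \<in> ?M" using a by (simp add: mem_ideal_diff_sumset_2)
    moreover have "x + y = (a + s + t) + a" using st by simp
    ultimately show ?thesis unfolding dilatation_def by blast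
  qed
  have "UNIV - dilatation S a \<subseteq> {..a} \<union> (\<lambda>s. s + a) ` (UNIV - S)"
  proof
    fix x assume x: "x \<in> UNIV - dilatation S a"
    show "x \<in> {..a} \<union> (\<lambda>s. s + a) ` (UNIV - S)"
    proof (cases "x \<le> a")
      case False
      then have e: "x = (x - a) + a" "x - a \<noteq> 0" by auto
      have "x - a \<notin> S"
      proof
        assume "x - a \<in> S"
        then have "x - a \<in> ?M" using e(2) by (simp add: maximal_ideal_def)
        then have "x \<in> dilatation S a" using e(1) unfolding dilatation_def by blast
        then show False using x by blast
      qed
      then show ?thesis using e(1) by blast
    qed simp
  qed
  moreover have "finite (UNIV - S)" using S by (simp add: numerical_semigroup_def)
  ultimately have "finite (UNIV - dilatation S a)"
    by (meson finite_UnI finite_atMost finite_imageI finite_subset)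
  then show ?thesis
    using closed by (auto simp: numerical_semigroup_def dilatation_def)
qed

lemma dilatation_neq_UNIV:
  assumes "0 \<in> S" and "S \<noteq> UNIV"
  shows "dilatation S a \<noteq> UNIV"
proof
  assume eq: "dilatation S a = UNIV"
  obtain x where x: "x \<notin> S" using assms(2) by blast
  then have "x + a \<in> dilatation S a" "x \<noteq> 0" using eq assms(1) by (auto intro: ccontr)
  then show False using x by (auto simp: dilatation_def maximal_ideal_def)
qed

end

theory Submission
  imports Defs
begin

text \<open>
  Write \<open>F\<close> for the Frobenius number of \<open>S\<close> and \<open>\<Omega>\<close> for its canonical ideal, and let \<open>a > 0\<close>.
  The dilatation has Frobenius number \<open>F + a\<close>, and its canonical ideal \<open>\<Omega>'\<close> arises from \<open>\<Omega>\<close> by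
  exchanging the element \<open>F + a\<close> for \<open>F\<close>. If \<open>S\<close> is symmetric, then \<open>\<Omega> = S\<close> and at most \<open>F + a\<close>
  lies in \<open>2\<Omega>' - \<Omega>'\<close>, so neither semigroup is 2-AGL. Otherwise \<open>F \<in> 2\<Omega>\<close>, while
  \<open>F + a \<in> 2\<Omega>'\<close> always holds; as both ideals contain \<open>0\<close> and \<open>2\<Omega>\<close> contains everything from \<open>F\<close>
  on, \<open>h\<Omega> = h\<Omega>'\<close> for all \<open>h \<ge> 2\<close>, and passing from \<open>2\<Omega> - \<Omega>\<close> to \<open>2\<Omega>' - \<Omega>'\<close> exchanges \<open>F\<close>
  for \<open>F + a\<close>.
\<close>

section \<open>Sumsets and the exchange of a single element\<close>

lemma sumset_1: "sumset 1 A = A"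
proof (intro set_eqI iffI)
  fix z assume "z \<in> A"
  then show "z \<in> sumset 1 A"
    unfolding sumset_def by (intro CollectI exI[of _ "\<lambda>_. z"]) simp
qed (auto simp: sumset_def)

lemma sumset_Suc: "sumset (Suc h) A = {x + y | x y. x \<in> sumset h A \<and> y \<in> A}"
proof (intro set_eqI iffI)
  fix z assume "z \<in> sumset (Suc h) A"
  then obtain f where "z = (\<Sum>i<h. f i) + f h" "\<forall>i<Suc h. f i \<in> A"
    by (auto simp: sumset_def)
  moreover from this have "(\<Sum>i<h. f i) \<in> sumset h A" "f h \<in> A"
    by (auto simp: sumset_def)
  ultimately show "z \<in> {x + y | x y. x \<in> sumset h A \<and> y \<in> A}" by blast
next
  fix z assume "z \<in> {x + y | x y. x \<in> sumset h A \<and> y \<in> A}"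
  then obtain f y where "z = (\<Sum>i<h. f i) + y" "\<forall>i<h. f i \<in> A" "y \<in> A"
    by (auto simp: sumset_def)
  then show "z \<in> sumset (Suc h) A"
    unfolding sumset_def
    by (intro CollectI exI[of _ "\<lambda>i. if i = h then y else f i"]) auto
qed

lemma sumset_subset_Suc:
  assumes "0 \<in> A"
  shows "sumset h A \<subseteq> sumset (Suc h) A"
  using assms by (force simp: sumset_Suc)

lemma subset_sumset_2:
  assumes "0 \<in> A"
  shows "A \<subseteq> sumset 2 A"
  using assms by (force simp: sumset_2)

lemma sumset_mono_exponent:
  assumes "0 \<in> A" "k \<le> h"
  shows "sumset k A \<subseteq> sumset h A"
  using assms(2) by (rule lift_Suc_mono_le[of "\<lambda>n. sumset n A", OF sumset_subset_Suc[OF assms(1)]])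

text \<open>A sum that uses the new element \<open>F\<close> is at least \<open>F\<close>, and
  \<open>2A\<close> contains everything from \<open>F\<close> on. A sum that loses \<open>c\<close>
  is at least \<open>c\<close>, and \<open>2B\<close> contains everything from \<open>c\<close>
  on.\<close>

lemma sumset_exchange:
  fixes F c :: nat
  assumes A: "0 \<in> A" "{F<..} \<subseteq> A" "F \<in> sumset 2 A"
    and c: "F < c" "c \<in> sumset 2 B"
    and B: "B = insert F A - {c}"
    and h: "2 \<le> h"
  shows "sumset h B = sumset h A"
  using h
proof (induction h rule: dec_induct)
  case base
  have B0: "0 \<in> B" and B_gt: "x \<in> B" if "c < x" for x
    using A c B that by auto
  have "x + y \<in> sumset 2 A" if xy: "x \<in> B" "y \<in> B" for x y
  proof (cases "x \<in> A \<and> y \<in> A")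
    case True
    then show ?thesis by (auto simp: sumset_2)
  next
    case False
    then have "F \<le> x + y" using xy B by auto
    then show ?thesis
      using A(3) subsetD[OF A(2), of "x + y"] subset_sumset_2[OF A(1)]
      by (cases "x + y = F") auto
  qed
  moreover have "x + y \<in> sumset 2 B" if xy: "x \<in> A" "y \<in> A" for x y
  proof (cases "x \<in> B \<and> y \<in> B")
    case True
    then show ?thesis by (auto simp: sumset_2)
  next
    case False
    then have "c \<le> x + y" using xy B by auto
    then show ?thesis
      using c(2) B_gt[of "x + y"] subset_sumset_2[OF B0] by (cases "x + y = c") auto
  qed
  ultimately show ?case unfolding sumset_2[of A] sumset_2[of B] by (auto simp: sumset_2)
next
  case (step h)
  have B0: "0 \<in> B" using A c B by auto
  \<comment> \<open>Since \<open>hA = hB\<close> by induction, only the last summand can differ, and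
    this bound absorbs every such sum.\<close>
  have ge: "x \<in> sumset h A" if "F \<le> x" for x
    using that A(3) subsetD[OF A(2), of x] subset_sumset_2[OF A(1)]
      sumset_mono_exponent[OF A(1) step(1)]
    by (cases "x = F") auto
  have "x + y \<in> sumset (Suc h) A" if xy: "x \<in> sumset h A" "y \<in> B" for x y
  proof (cases "y \<in> A")
    case True
    then show ?thesis using xy by (auto simp: sumset_Suc)
  next
    case False
    then have "F \<le> x + y" using xy B by auto
    then show ?thesis using ge sumset_subset_Suc[OF A(1)] by blast
  qed
  moreover have "x + y \<in> sumset (Suc h) B" if xy: "x \<in> sumset h A" "y \<in> A" for x y
  proof (cases "y \<in> B")
    case True
    then show ?thesis using xy step.IH by (auto simp: sumset_Suc)
  next
    case False
    then have "F \<le> x + y" using xy B c by auto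
    then show ?thesis using ge sumset_subset_Suc[OF B0, of h] step.IH by blast
  qed
  ultimately show ?case
    unfolding sumset_Suc[of h A] sumset_Suc[of h B] step.IH
    by (auto simp: sumset_Suc step.IH)
qed

section \<open>Frobenius number and canonical ideal of a dilatation\<close>

lemma mem_canonical_ideal: "x \<in> canonical_ideal S \<longleftrightarrow> frobenius S < x \<or> frobenius S - x \<notin> S"
proof -
  \<comment> \<open>For \<open>x\<close> past the Frobenius number the truncated difference would be
    0, so that range needs its own disjunct.\<close>
  have "int (frobenius S) - int x \<in> int ` S \<longleftrightarrow> x \<le> frobenius S \<and> frobenius S - x \<in> S"
  proof
    assume "int (frobenius S) - int x \<in> int ` S"
    then obtain s where s: "s \<in> S" "int (frobenius S) - int x = int s" by blast
    then have "x \<le> frobenius S" "frobenius S - x = s" by linarith+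
    then show "x \<le> frobenius S \<and> frobenius S - x \<in> S" using s by blast
  next
    assume "x \<le> frobenius S \<and> frobenius S - x \<in> S"
    then show "int (frobenius S) - int x \<in> int ` S"
      by (intro image_eqI[of _ _ "frobenius S - x"]) (auto simp: of_nat_diff)
  qed
  then show ?thesis by (auto simp: canonical_ideal_def)
qed

lemma frobenius_notin:
  assumes "numerical_semigroup S" "S \<noteq> UNIV"
  shows "frobenius S \<notin> S"
  using Max_in[of "UNIV - S"] assms by (auto simp: numerical_semigroup_def frobenius_def)

lemma frobenius_less_mem:
  assumes "numerical_semigroup S" "frobenius S < x"
  shows "x \<in> S"
proof (rule ccontr)
  assume "x \<notin> S"
  then have "x \<le> frobenius S"
    using assms(1) by (simp add: numerical_semigroup_def frobenius_def)
  then show False using assms(2) by simp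
qed

lemma mem_dilatation_add: "x + a \<in> dilatation S a \<longleftrightarrow> x + a = 0 \<or> x \<in> S - {0}"
  by (auto simp: dilatation_def maximal_ideal_def)

lemma dilatation_ge: "x \<in> dilatation S a \<Longrightarrow> x = 0 \<or> a < x"
  by (auto simp: dilatation_def maximal_ideal_def)

lemma frobenius_dilatation:
  assumes S: "numerical_semigroup S" "S \<noteq> UNIV"
  shows "frobenius (dilatation S a) = frobenius S + a"
  unfolding frobenius_def[of "dilatation S a"]
proof (rule Max_eqI)
  \<comment> \<open>Ensures that \<open>frobenius S + a\<close> is not the adjoined element
    0.\<close>
  have F0: "frobenius S \<noteq> 0"
    using S frobenius_notin by (metis numerical_semigroup_def)
  show "frobenius S + a \<in> UNIV - dilatation S a"
    using frobenius_notin[OF S] F0 by (simp add: mem_dilatation_add)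
  have le: "x \<le> frobenius S + a" if "x \<in> UNIV - dilatation S a" for x
  proof (rule ccontr)
    assume x: "\<not> x \<le> frobenius S + a"
    then have "x - a \<in> S - {0}" using frobenius_less_mem[OF S(1), of "x - a"] by auto
    moreover have "x = (x - a) + a" using x by simp
    ultimately show False using that mem_dilatation_add by (metis DiffD2)
  qed
  then show "x \<le> frobenius S + a" if "x \<in> UNIV - dilatation S a" for x
    using that by blast
  show "finite (UNIV - dilatation S a)"
    using le by (meson finite_nat_set_iff_bounded_le)
qed

text \<open>For \<open>x \<le> F\<close>, the reflection \<open>(F - x) + a\<close> lies in the
  dilatation iff \<open>F - x\<close> is a nonzero element of \<open>S\<close>, so only
  \<open>x = F\<close> changes status. For \<open>F < x \<le> F + a\<close>, the reflection is below
  \<open>a\<close> and belongs to the dilatation only if it is 0.\<close>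

lemma canonical_ideal_dilatation:
  assumes S: "numerical_semigroup S" "S \<noteq> UNIV" and a: "0 < a"
  shows "canonical_ideal (dilatation S a)
    = insert (frobenius S) (canonical_ideal S) - {frobenius S + a}"
proof (rule set_eqI)
  fix x
  let ?F = "frobenius S"
  consider "x \<le> ?F" | "?F < x" "x \<le> ?F + a" | "?F + a < x" by linarith
  then show "x \<in> canonical_ideal (dilatation S a)
      \<longleftrightarrow> x \<in> insert ?F (canonical_ideal S) - {?F + a}"
  proof cases
    case 1
    then have "?F + a - x = (?F - x) + a" by simp
    then have "?F + a - x \<in> dilatation S a \<longleftrightarrow> ?F - x \<in> S - {0}"
      using a by (simp add: mem_dilatation_add del: add_diff_assoc add_diff_assoc2)
    then show ?thesis
      using 1 a by (auto simp: mem_canonical_ideal frobenius_dilatation[OF S])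
  next
    case 2
    then have "?F + a - x \<in> dilatation S a \<longleftrightarrow> x = ?F + a"
      using dilatation_ge[of "?F + a - x" S a] by (auto simp: dilatation_def)
    then show ?thesis
      using 2 by (auto simp: mem_canonical_ideal frobenius_dilatation[OF S])
  next
    case 3
    then show ?thesis
      by (auto simp: mem_canonical_ideal frobenius_dilatation[OF S])
  qed
qed

section \<open>Frobenius numbers as sums of two elements of the canonical ideals\<close>

lemma numerical_semigroup_mult:
  assumes "numerical_semigroup S" "m \<in> S"
  shows "k * m \<in> S"
  using assms by (induction k) (auto simp: numerical_semigroup_def)

text \<open>If \<open>x\<close> lies in the canonical ideal but not in \<open>S\<close>, then so
  does \<open>F - x\<close> in the ideal, since its reflection is \<open>x\<close>; the two add up
  to \<open>F\<close>.\<close>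

lemma frobenius_mem_sumset_canonical_ideal:
  assumes S: "numerical_semigroup S" "S \<noteq> UNIV" and ne: "canonical_ideal S \<noteq> S"
  shows "frobenius S \<in> sumset 2 (canonical_ideal S)"
proof -
  let ?F = "frobenius S"
  have "S \<subseteq> canonical_ideal S"
  proof
    fix x assume x: "x \<in> S"
    show "x \<in> canonical_ideal S"
    proof (rule ccontr)
      assume "x \<notin> canonical_ideal S"
      then have "x \<le> ?F" "?F - x \<in> S" by (auto simp: mem_canonical_ideal)
      then have "?F - x + x \<in> S" using S(1) x unfolding numerical_semigroup_def by blast
      then show False using frobenius_notin[OF S] \<open>x \<le> ?F\<close> by simp
    qed
  qed
  then obtain x where x: "x \<in> canonical_ideal S" "x \<notin> S" using ne by blast
  then have "x \<le> ?F" using frobenius_less_mem[OF S(1)] not_le by blast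
  then have "?F - x \<in> canonical_ideal S" "?F = x + (?F - x)"
    using x by (auto simp: mem_canonical_ideal)
  then show ?thesis using x(1) unfolding sumset_2 by blast
qed

text \<open>The sum \<open>F + a\<close> itself works unless \<open>a\<close> is missing from the
  ideal. In that case a small gap \<open>t\<close> of \<open>S\<close> is shifted between the
  summands: \<open>(F - t) + (a + t)\<close> with \<open>a + t\<close> in \<open>S\<close>.\<close>

lemma frobenius_add_mem_sumset_canonical_ideal_dilatation:
  assumes S: "numerical_semigroup S" "S \<noteq> UNIV" and a: "0 < a"
  shows "frobenius S + a \<in> sumset 2 (canonical_ideal (dilatation S a))"
proof -
  let ?F = "frobenius S"
  let ?K = "insert ?F (canonical_ideal S) - {?F + a}"
  have S0: "0 \<in> S" and add: "\<And>x y. x \<in> S \<Longrightarrow> y \<in> S \<Longrightarrow> x + y \<in> S"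
    using S(1) by (auto simp: numerical_semigroup_def)
  have F: "?F \<notin> S" using S by (rule frobenius_notin)
  have "0 < ?F" using S0 F by (metis gr0I)
  have "\<exists>x y. ?F + a = x + y \<and> x \<in> ?K \<and> y \<in> ?K"
  proof (cases "a \<in> ?K")
    case True
    then show ?thesis using a by (intro exI[of _ ?F] exI[of _ a]) auto
  next
    case False
    then have aF: "a < ?F" "?F - a \<in> S"
      using \<open>0 < ?F\<close> by (auto simp: mem_canonical_ideal)
    define m where "m = (LEAST m. m \<in> S \<and> 0 < m)"
    \<comment> \<open>The last bound will give \<open>a + t < ?F\<close> for \<open>t < m\<close>,
      so no subtraction below truncates.\<close>
    have m: "m \<in> S" "0 < m" "m \<le> ?F - a"
      unfolding m_def using LeastI[of "\<lambda>m. m \<in> S \<and> 0 < m" "?F - a"]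
        Least_le[of "\<lambda>m. m \<in> S \<and> 0 < m" "?F - a"] aF by auto
    have below_m: "t \<notin> S" if "0 < t" "t < m" for t
      using that not_less_Least unfolding m_def by blast
    \<comment> \<open>The gap \<open>t\<close> rounds \<open>a\<close> up to a multiple of the multiplicity \<open>m\<close>.\<close>
    define t where "t = m - a mod m"
    \<comment> \<open>Otherwise \<open>t\<close> would be \<open>m\<close>, which is not a
      gap.\<close>
    have "a mod m \<noteq> 0"
    proof
      assume "a mod m = 0"
      then have "a \<in> S" using numerical_semigroup_mult[OF S(1) m(1), of "a div m"]
        by (simp add: mod_eq_0_iff_dvd)
      then show False using add[OF aF(2), of a] aF(1) F by simp
    qed
    then have t: "0 < t" "t < m" using m(2) by (auto simp: t_def)
    then have tS: "t \<notin> S" by (rule below_m)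
    have at: "a + t = (a div m + 1) * m"
    proof -
      have "a mod m < m" using m(2) by simp
      then have "a + t = a - a mod m + m" unfolding t_def
        using mod_less_eq_dividend[of a m] by linarith
      then show ?thesis by (simp add: minus_mod_eq_div_mult)
    qed
    have "?F - (a + t) \<notin> S"
    proof
      assume "?F - (a + t) \<in> S"
      then have "?F - (a + t) + (a + t) \<in> S"
        using add numerical_semigroup_mult[OF S(1) m(1)] at by metis
      then show False using F t m aF by simp
    qed
    then have "a + t \<in> ?K" "?F - t \<in> ?K"
      using t tS m aF by (auto simp: mem_canonical_ideal)
    moreover have "?F + a = (a + t) + (?F - t)" using t m by simp
    ultimately show ?thesis by blast
  qed
  then show ?thesis
    unfolding canonical_ideal_dilatation[OF S a] sumset_2 by blast
qed

theorem corollary3p5: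
  fixes S :: "nat set" and a :: nat
  assumes "numerical_semigroup S"
    and "S \<noteq> UNIV"
    and "a \<in> ideal_diff (maximal_ideal S) (sumset 2 (maximal_ideal S))"
  shows "two_AGL (dilatation S a) \<longleftrightarrow> two_AGL S"
proof (cases "a = 0")
  case True
  then have "dilatation S a = S"
    using assms(1) by (auto simp: dilatation_def maximal_ideal_def numerical_semigroup_def)
  then show ?thesis by simp
next
  case False
  then have a: "0 < a" by simp
  note S = assms(1,2)
  let ?F = "frobenius S"
  let ?A = "canonical_ideal S"
  let ?B = "canonical_ideal (dilatation S a)"
  note B = canonical_ideal_dilatation[OF S a]
  have S0: "0 \<in> S" and add: "\<And>x y. x \<in> S \<Longrightarrow> y \<in> S \<Longrightarrow> x + y \<in> S"
    using S(1) by (auto simp: numerical_semigroup_def)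
  show ?thesis
  proof (cases "?A = S")
    case True
    have "sumset 2 ?A \<subseteq> ?A" using add unfolding True sumset_2 by blast
    then have "\<not> two_AGL S" by (simp add: two_AGL_def Diff_eq_empty_iff[THEN iffD2])
    \<comment> \<open>Thus \<open>insert ?F S\<close> is closed under addition, and
      \<open>?B\<close> omits only \<open>?F + a\<close> from it.\<close>
    moreover have "x + y \<in> insert ?F S" if "x \<in> insert ?F S" "y \<in> insert ?F S" for x y
    proof (cases "x \<in> S \<and> y \<in> S")
      case False
      then have "?F \<le> x + y" using that by auto
      then show ?thesis using frobenius_less_mem[OF S(1), of "x + y"] by fastforce
    qed (simp add: add)
    then have "sumset 2 ?B - ?B \<subseteq> {?F + a}"
      unfolding B True sumset_2 by blast
    then have "card (sumset 2 ?B - ?B) \<le> 1"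
      using card_mono[of "{?F + a}"] by fastforce
    then have "\<not> two_AGL (dilatation S a)" by (simp add: two_AGL_def)
    ultimately show ?thesis by simp
  next
    case False
    have A: "0 \<in> ?A" "{?F<..} \<subseteq> ?A" "?F \<notin> ?A"
      using frobenius_notin[OF S] S0 by (auto simp: mem_canonical_ideal)
    have F2: "?F \<in> sumset 2 ?A"
      using frobenius_mem_sumset_canonical_ideal[OF S False] .
    have c2: "?F + a \<in> sumset 2 ?B"
      using frobenius_add_mem_sumset_canonical_ideal_dilatation[OF S a] .
    have eq: "sumset h ?B = sumset h ?A" if "2 \<le> h" for h
      using sumset_exchange[OF A(1,2) F2 _ c2 B that] a by simp
    let ?D = "sumset 2 ?A - ?A - {?F}"
    have fin: "finite ?D"
      using A(2) by (intro finite_subset[of ?D "{..?F}"]) (auto simp: not_le[symmetric])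
    have "sumset 2 ?A - ?A = insert ?F ?D" using F2 A(3) by blast
    moreover have "sumset 2 ?B - ?B = insert (?F + a) ?D"
      using c2 a A(2) unfolding eq[OF order_refl] unfolding B by auto
    moreover have "?F + a \<notin> ?D" "?F \<notin> ?D" using A(2) a by auto
    ultimately have card: "card (sumset 2 ?B - ?B) = card (sumset 2 ?A - ?A)"
      using fin by (metis card_insert_disjoint)
    \<comment> \<open>The two sets minimised over are equal, so no stabilisation of the chain
      \<open>h \<mapsto> h\<Omega>\<close> is needed to rule out a junk value of the minimum.\<close>
    have "reduction_number ?B = reduction_number ?A"
      if "card (sumset 2 ?A - ?A) = 2"
    proof -
      \<comment> \<open>This excludes \<open>h = 1\<close>, the only positive exponent at which the
        sumsets of \<open>?A\<close> and \<open>?B\<close> differ.\<close>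
      have "sumset 2 ?A \<noteq> ?A" "sumset 2 ?B \<noteq> ?B" using that card by auto
      then have "h \<ge> 1 \<and> sumset h ?B = sumset (h + 1) ?B
          \<longleftrightarrow> h \<ge> 1 \<and> sumset h ?A = sumset (h + 1) ?A" for h
        using eq[of h] eq[of "h + 1"] sumset_1[of ?A] sumset_1[of ?B]
        by (cases "h = 1") (auto simp: numeral_2_eq_2)
      then show ?thesis by (simp add: reduction_number_def)
    qed
    then show ?thesis using card by (auto simp: two_AGL_def)
  qed
qed

end
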